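(* Assume the Principle of Dependent Choice in the ambient universe. Let $\mathcal{G}$ be the group of all order automorphisms (order-preserving bijections) of $(\mathbb{Q},<)$, and let $\mathcal{F}$ be the filter of subgroups of $\mathcal{G}$ generated by $\{\mathrm{fix}(E): E\subseteq\mathbb{Q}\text{ is nowhere dense}\}$, where $\mathrm{fix}(E)=\{\pi\in\mathcal{G}:\pi(q)=q\text{ for all }q\in E\}$. Then $\mathcal{F}$ is shift complete, but $\mathcal{F}$ is not closed under countable intersections.
   Context: Nowhere dense refers to the usual order topology on $\mathbb{Q}$. A filter of subgroups of a group $\mathcal{G}$ is a non-empty set of subgroups of $\mathcal{G}$ closed under supergroups (that are subgroups of $\mathcal{G}$) and finite intersections; it is normal if it is closed under conjugation by elements of $\mathcal{G}$. The filter generated by a family of subgroups consists of all subgroups of $\mathcal{G}$ containing a finite intersection of members of the family. A normal filter $\mathcal{F}$ of subgroups of $\mathcal{G}$ is shift complete if for every decreasing (with respect to inclusion) sequence $\langle H_n:n\in\omega\rangle$ of elements of $\mathcal{F}$ there are $\pi_n\in\mathcal{G}$ ($n\in\omega$) such that, setting $\sigma_n=\pi_{n-1}\circ\dots\circ\pi_0$ (with $\sigma_0=\mathrm{id}$) and $K_n=\sigma_nH_n\sigma_n^{-1}$, one has $\pi_n\in K_n$ for every $n\in\omega$ and $\bigcap_{n\in\omega}K_n\in\mathcal{F}$. (In particular, shift completeness of $\mathcal{F}$ includes that $\mathcal{F}$ is normal.) *)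

theory Defs
  imports "HOL-Analysis.Elementary_Topology" "HOL-Library.Countable_Set" "HOL-Algebra.Coset"
begin

section \<open>Filters of subgroups and shift completeness\<close>

definition conj_subgroup :: "('a, 'b) monoid_scheme \<Rightarrow> 'a \<Rightarrow> 'a set \<Rightarrow> 'a set" where
  "conj_subgroup G g H = g <#\<^bsub>G\<^esub> H #>\<^bsub>G\<^esub> inv\<^bsub>G\<^esub> g"

definition subgroup_filter :: "('a, 'b) monoid_scheme \<Rightarrow> 'a set set \<Rightarrow> bool" where
  "subgroup_filter G F \<longleftrightarrow>
     group G \<and> F \<noteq> {} \<and> (\<forall>H\<in>F. subgroup H G) \<and>
     (\<forall>H\<in>F. \<forall>K. subgroup K G \<and> H \<subseteq> K \<longrightarrow> K \<in> F) \<and>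
     (\<forall>H\<in>F. \<forall>K\<in>F. H \<inter> K \<in> F)"

definition normal_subgroup_filter :: "('a, 'b) monoid_scheme \<Rightarrow> 'a set set \<Rightarrow> bool" where
  "normal_subgroup_filter G F \<longleftrightarrow>
     subgroup_filter G F \<and> (\<forall>g\<in>carrier G. \<forall>H\<in>F. conj_subgroup G g H \<in> F)"

text \<open>Intersecting with the carrier makes the intersection of the empty family the whole group.\<close>

definition filter_generated_by :: "('a, 'b) monoid_scheme \<Rightarrow> 'a set set \<Rightarrow> 'a set set" where
  "filter_generated_by G S =
     {H. subgroup H G \<and> (\<exists>T. finite T \<and> T \<subseteq> S \<and> carrier G \<inter> \<Inter>T \<subseteq> H)}"

text \<open>\<open>shift_prod G p n\<close> is the product of \<open>p (n-1)\<close>, \dots, \<open>p 0\<close>, in this order.\<close>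

primrec shift_prod :: "('a, 'b) monoid_scheme \<Rightarrow> (nat \<Rightarrow> 'a) \<Rightarrow> nat \<Rightarrow> 'a" where
  "shift_prod G p 0 = \<one>\<^bsub>G\<^esub>"
| "shift_prod G p (Suc n) = p n \<otimes>\<^bsub>G\<^esub> shift_prod G p n"

definition shift_complete :: "('a, 'b) monoid_scheme \<Rightarrow> 'a set set \<Rightarrow> bool" where
  "shift_complete G F \<longleftrightarrow>
     normal_subgroup_filter G F \<and>
     (\<forall>H :: nat \<Rightarrow> 'a set. (\<forall>n. H n \<in> F) \<and> decseq H \<longrightarrow>
        (\<exists>p :: nat \<Rightarrow> 'a. (\<forall>n. p n \<in> carrier G) \<and>
           (let K = (\<lambda>n. conj_subgroup G (shift_prod G p n) (H n))
            in (\<forall>n. p n \<in> K n) \<and> (\<Inter>n. K n) \<in> F)))"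

definition closed_under_countable_intersections :: "'a set set \<Rightarrow> bool" where
  "closed_under_countable_intersections F \<longleftrightarrow>
     (\<forall>S. S \<subseteq> F \<and> countable S \<and> S \<noteq> {} \<longrightarrow> \<Inter>S \<in> F)"

section \<open>The order topology on the rationals\<close>

instantiation rat :: linorder_topology
begin

definition open_rat :: "rat set \<Rightarrow> bool" where
  "open_rat = generate_topology (range (\<lambda>a. {..<a}) \<union> range (\<lambda>a. {a<..}))"

instance
  by standard (rule open_rat_def)

end

definition nowhere_dense :: "'a::topological_space set \<Rightarrow> bool" where
  "nowhere_dense E \<longleftrightarrow> interior (closure E) = {}"

section \<open>The automorphism group of the rational order\<close>

definition rat_aut_group :: "(rat \<Rightarrow> rat) monoid" where
  "rat_aut_group =
     \<lparr>carrier = {f. bij f \<and> strict_mono f}, monoid.mult = (\<circ>), one = id\<rparr>"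

lemma strict_mono_inv_rat:
  fixes f :: "rat \<Rightarrow> rat"
  assumes "bij f" "strict_mono f"
  shows "strict_mono (inv_into UNIV f)"
proof (rule strict_monoI)
  fix x y :: rat
  assume "x < y"
  then have "f (inv_into UNIV f x) < f (inv_into UNIV f y)"
    using assms(1) by (simp add: bij_is_surj surj_f_inv_f)
  then show "inv_into UNIV f x < inv_into UNIV f y"
    using assms(2) by (simp add: strict_mono_less)
qed

lemma group_rat_aut_group: "group rat_aut_group"
proof (rule groupI)
  fix f assume "f \<in> carrier rat_aut_group"
  then have f: "bij f" "strict_mono f" by (simp_all add: rat_aut_group_def)
  then have "inv_into UNIV f \<in> carrier rat_aut_group"
    by (simp add: rat_aut_group_def bij_imp_bij_inv strict_mono_inv_rat)
  moreover have "inv_into UNIV f \<otimes>\<^bsub>rat_aut_group\<^esub> f = \<one>\<^bsub>rat_aut_group\<^esub>"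
    using f by (simp add: rat_aut_group_def bij_is_inj)
  ultimately show "\<exists>g\<in>carrier rat_aut_group. g \<otimes>\<^bsub>rat_aut_group\<^esub> f = \<one>\<^bsub>rat_aut_group\<^esub>"
    by blast
qed (auto simp: rat_aut_group_def bij_comp strict_mono_def comp_assoc)

definition fix_subgroup :: "rat set \<Rightarrow> (rat \<Rightarrow> rat) set" where
  "fix_subgroup E = {f \<in> carrier rat_aut_group. \<forall>q\<in>E. f q = q}"

definition nowhere_dense_filter :: "(rat \<Rightarrow> rat) set set" where
  "nowhere_dense_filter =
     filter_generated_by rat_aut_group {fix_subgroup E | E. nowhere_dense E}"

end

theory Submission
  imports Defs
begin

text \<open>
  For shift completeness, choose closed nowhere dense \<open>E\<^sub>0 \<subseteq> E\<^sub>1 \<subseteq> \<dots>\<close> with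
  \<open>fix(E\<^sub>n) \<subseteq> H\<^sub>n\<close>. If each \<open>\<pi>\<^sub>n\<close> fixes \<open>\<sigma>\<^sub>n[E\<^sub>n]\<close> pointwise, then
  the intersection of the \<open>K\<^sub>n\<close> contains \<open>fix(D)\<close> for the increasing union \<open>D\<close> of the sets
  \<open>\<sigma>\<^sub>n[E\<^sub>n]\<close>. The \<open>\<pi>\<^sub>n\<close> are chosen to make \<open>D\<close> nowhere dense: along an enumeration of
  the open intervals, one reserves in the \<open>n\<close>-th interval a gap of \<open>\<sigma>\<^sub>n[E\<^sub>n]\<close>, and
  \<open>\<pi>\<^sub>n\<close> pushes \<open>\<sigma>\<^sub>n[E\<^sub>n\<^sub>+\<^sub>1]\<close> out of the finitely many intervals reserved so far. This is
  possible since a nowhere dense set has a gap next to every point, which an automorphism can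
  stretch over the reserved interval.

  The intersection of the groups \<open>fix({q})\<close> over all rationals \<open>q\<close> is trivial, while
  \<open>fix(E)\<close> is never trivial for nowhere dense \<open>E\<close>.
\<close>

section \<open>Nowhere dense sets of rationals\<close>

lemma open_rat_contains_interval:
  fixes S :: "rat set"
  assumes "open S" "x \<in> S"
  obtains a b where "a < x" "x < b" "{a..b} \<subseteq> S"
proof -
  obtain b where b: "b > x" "{x..<b} \<subseteq> S"
    using open_right[OF assms, of "x + 1"] by auto
  obtain a where a: "a < x" "{a<..x} \<subseteq> S"
    using open_left[OF assms, of "x - 1"] by auto
  obtain a' where a': "a < a'" "a' < x" using dense a(1) by blast
  obtain b' where b': "x < b'" "b' < b" using dense b(1) by blast
  have "{a'..b'} \<subseteq> S"
  proof
    fix t assume "t \<in> {a'..b'}"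
    then show "t \<in> S" using a b a' b' by (cases "t \<le> x") auto
  qed
  with a' b' that show ?thesis by blast
qed

text \<open>Forward: removing the closure of \<open>E\<close> from an open interval leaves a
  nonempty open set, which contains a closed interval. Backward: the open interior of a gap also
  misses the closure. This order-theoretic form is the one that order automorphisms transport
  directly.\<close>

lemma nowhere_dense_rat_iff:
  fixes E :: "rat set"
  shows "nowhere_dense E \<longleftrightarrow>
    (\<forall>a b. a < b \<longrightarrow> (\<exists>c d. a < c \<and> c < d \<and> d < b \<and> {c..d} \<inter> E = {}))"
proof
  assume E: "nowhere_dense E"
  show "\<forall>a b. a < b \<longrightarrow> (\<exists>c d. a < c \<and> c < d \<and> d < b \<and> {c..d} \<inter> E = {})"
  proof (intro allI impI)
    fix a b :: rat assume "a < b"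
    then have "{a<..<b} \<noteq> {}" using dense by auto
    then have "\<not> {a<..<b} \<subseteq> closure E"
      using E interior_maximal[of "{a<..<b}" "closure E"] by (auto simp: nowhere_dense_def)
    then obtain x where x: "x \<in> {a<..<b} - closure E" by blast
    have "open ({a<..<b} - closure E)" by (intro open_Diff) auto
    from open_rat_contains_interval[OF this x] obtain c d where
      cd: "c < x" "x < d" "{c..d} \<subseteq> {a<..<b} - closure E" by blast
    have "c \<in> {c..d}" "d \<in> {c..d}" using cd(1,2) by auto
    then have "c \<in> {a<..<b}" "d \<in> {a<..<b}" using cd(3) by blast+
    moreover have "{c..d} \<inter> E = {}" using cd(3) closure_subset[of E] by blast
    ultimately show "\<exists>c d. a < c \<and> c < d \<and> d < b \<and> {c..d} \<inter> E = {}"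
      using cd(1,2) less_trans by (intro exI[of _ c] exI[of _ d]) auto
  qed
next
  assume gaps: "\<forall>a b. a < b \<longrightarrow> (\<exists>c d. a < c \<and> c < d \<and> d < b \<and> {c..d} \<inter> E = {})"
  show "nowhere_dense E"
    unfolding nowhere_dense_def
  proof (rule ccontr)
    assume "interior (closure E) \<noteq> {}"
    then obtain x where "x \<in> interior (closure E)" by blast
    from open_rat_contains_interval[OF open_interior this] obtain a b where
      ab: "a < x" "x < b" "{a..b} \<subseteq> interior (closure E)" by blast
    then have "a < b" by simp
    then obtain c d where cd: "a < c" "c < d" "d < b" "{c..d} \<inter> E = {}"
      using gaps by blast
    obtain t where t: "c < t" "t < d" using dense cd(2) by blast
    have "t \<in> {a..b}" using cd(1,3) t by auto
    then have "t \<in> closure E" using ab(3) interior_subset[of "closure E"] by blast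
    moreover have "{c<..<d} \<inter> closure E = {}"
      using cd(4) by (subst open_Int_closure_eq_empty) (auto simp: disjoint_iff)
    ultimately show False using t by auto
  qed
qed

lemma nowhere_dense_rat_gap:
  fixes E :: "rat set"
  assumes "nowhere_dense E" "a < b"
  obtains c d where "a < c" "c < d" "d < b" "{c..d} \<inter> E = {}"
  using assms unfolding nowhere_dense_rat_iff by blast

lemma nowhere_dense_closure: "nowhere_dense E \<Longrightarrow> nowhere_dense (closure E)"
  by (simp add: nowhere_dense_def)

lemma nowhere_dense_rat_Un:
  fixes D E :: "rat set"
  assumes "nowhere_dense D" "nowhere_dense E"
  shows "nowhere_dense (D \<union> E)"
  unfolding nowhere_dense_rat_iff
proof (intro allI impI)
  fix a b :: rat assume "a < b"
  with assms(1) obtain c d where cd: "a < c" "c < d" "d < b" "{c..d} \<inter> D = {}"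
    by (rule nowhere_dense_rat_gap)
  obtain c' d' where "c < c'" "c' < d'" "d' < d" "{c'..d'} \<inter> E = {}"
    using assms(2) cd(2) by (rule nowhere_dense_rat_gap)
  moreover from this have "{c'..d'} \<subseteq> {c..d}" by auto
  then have "{c'..d'} \<inter> D = {}" using cd(4) by blast
  ultimately show "\<exists>c d. a < c \<and> c < d \<and> d < b \<and> {c..d} \<inter> (D \<union> E) = {}"
    using cd(1-3) by (intro exI[of _ c'] exI[of _ d']) (auto simp: Int_Un_distrib)
qed

lemma nowhere_dense_empty: "nowhere_dense {}"
  by (simp add: nowhere_dense_def)

lemma nowhere_dense_rat_UN:
  fixes E :: "'a \<Rightarrow> rat set"
  assumes "finite I" "\<And>i. i \<in> I \<Longrightarrow> nowhere_dense (E i)"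
  shows "nowhere_dense (\<Union>i\<in>I. E i)"
  using assms by induction (auto intro: nowhere_dense_rat_Un nowhere_dense_empty)

lemma nowhere_dense_rat_singleton: "nowhere_dense {q :: rat}"
  unfolding nowhere_dense_rat_iff
proof (intro allI impI)
  fix a b :: rat assume "a < b"
  \<comment> \<open>With \<open>w < x < y < z\<close> inside the interval, at least one of
    \<open>{w..x}\<close> and \<open>{y..z}\<close> avoids \<open>q\<close>.\<close>
  then obtain x where x: "a < x" "x < b" using dense by blast
  obtain y where y: "x < y" "y < b" using dense x by blast
  obtain z where z: "y < z" "z < b" using dense y by blast
  obtain w where w: "a < w" "w < x" using dense x by blast
  show "\<exists>c d. a < c \<and> c < d \<and> d < b \<and> {c..d} \<inter> {q} = {}"
  proof (cases "q \<le> x")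
    case True
    then show ?thesis using x y z by (intro exI[of _ y] exI[of _ z]) auto
  next
    case False
    then show ?thesis using x w by (intro exI[of _ w] exI[of _ x]) auto
  qed
qed

section \<open>Automorphisms of the rational order\<close>

lemma rat_aut_simps [simp]:
  "f \<in> carrier rat_aut_group \<longleftrightarrow> bij f \<and> strict_mono f"
  "f \<otimes>\<^bsub>rat_aut_group\<^esub> g = f \<circ> g"
  "\<one>\<^bsub>rat_aut_group\<^esub> = id"
  by (simp_all add: rat_aut_group_def)

lemma inv_rat_aut:
  assumes "bij f" "strict_mono f"
  shows "inv\<^bsub>rat_aut_group\<^esub> f = inv_into UNIV f"
  by (rule group.inv_equality[OF group_rat_aut_group])
     (use assms in \<open>auto simp: bij_is_inj bij_imp_bij_inv strict_mono_inv_rat\<close>)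

lemma rat_aut_comp:
  fixes f g :: "rat \<Rightarrow> rat"
  assumes "bij f" "strict_mono f" "bij g" "strict_mono g"
  shows "bij (f \<circ> g)" "strict_mono (f \<circ> g)"
  using assms by (auto intro: bij_comp simp: strict_mono_def)

text \<open>The image is the preimage under the inverse, and the inverse is continuous because it is
  monotone and surjective.\<close>

lemma closed_image_rat_aut:
  fixes f :: "rat \<Rightarrow> rat"
  assumes f: "bij f" "strict_mono f" and "closed S"
  shows "closed (f ` S)"
proof -
  have "continuous_on UNIV (inv_into UNIV f)"
    using strict_mono_mono[OF strict_mono_inv_rat[OF f]] bij_imp_bij_inv[OF f(1)]
    by (intro continuous_onI_mono) (auto simp: bij_is_surj mono_def)
  then have "closed (inv_into UNIV f -` S)" using \<open>closed S\<close> by (simp add: closed_vimage)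
  then show ?thesis using f(1) by (simp add: bij_vimage_eq_inv_image bij_imp_bij_inv inv_inv_eq)
qed

lemma nowhere_dense_image_rat_aut:
  fixes f :: "rat \<Rightarrow> rat"
  assumes f: "bij f" "strict_mono f" and E: "nowhere_dense E"
  shows "nowhere_dense (f ` E)"
  unfolding nowhere_dense_rat_iff
proof (intro allI impI)
  fix a b :: rat assume "a < b"
  have f_inv: "f (inv_into UNIV f x) = x" for x
    using f(1) by (simp add: bij_is_surj surj_f_inv_f)
  have "inv_into UNIV f a < inv_into UNIV f b"
    using strict_mono_inv_rat[OF f] \<open>a < b\<close> by (simp add: strict_monoD)
  with E obtain c d where
    cd: "inv_into UNIV f a < c" "c < d" "d < inv_into UNIV f b" "{c..d} \<inter> E = {}"
    by (rule nowhere_dense_rat_gap)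
  have "{f c..f d} \<inter> f ` E = {}"
    using cd(4) f(2) by (auto simp: strict_mono_less_eq)
  moreover have "a < f c" "f c < f d" "f d < b"
    using strict_monoD[OF f(2)] cd(1-3) f_inv by metis+
  ultimately show "\<exists>c d. a < c \<and> c < d \<and> d < b \<and> {c..d} \<inter> f ` E = {}" by blast
qed

section \<open>Piecewise linear automorphisms\<close>

text \<open>The piecewise linear map that carries \<open>x\<close> to \<open>y\<close> and is the
  identity outside the interval from \<open>l\<close> to \<open>r\<close>. The right piece is
  measured from \<open>r\<close>, so both pieces are scalings about a fixed endpoint, and exchanging
  \<open>x\<close> and \<open>y\<close> inverts both slopes.\<close>

definition bump :: "rat \<Rightarrow> rat \<Rightarrow> rat \<Rightarrow> rat \<Rightarrow> rat \<Rightarrow> rat" where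
  "bump l r x y t =
     (if t \<le> l \<or> r \<le> t then t
      else if t \<le> x then l + (t - l) * ((y - l) / (x - l))
      else r - (r - t) * ((r - y) / (r - x)))"

text \<open>The two pieces have ranges separated by \<open>y\<close>. This decides which branch the
  inverse \<open>bump l r y x\<close> uses and orders values taken on different pieces.\<close>

lemma bump_range:
  assumes "l < x" "x < r" "l < y" "y < r"
  shows "l < t \<Longrightarrow> t \<le> x \<Longrightarrow> l < bump l r x y t \<and> bump l r x y t \<le> y"
    and "x < t \<Longrightarrow> t < r \<Longrightarrow> y < bump l r x y t \<and> bump l r x y t < r"
proof -
  assume "l < t" "t \<le> x"
  have k: "(y - l) / (x - l) > 0" using assms by simp
  have "(t - l) * ((y - l) / (x - l)) \<le> (x - l) * ((y - l) / (x - l))"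
    using \<open>t \<le> x\<close> k by (intro mult_right_mono) auto
  moreover have "(t - l) * ((y - l) / (x - l)) > 0"
    using \<open>l < t\<close> k by (intro mult_pos_pos) auto
  moreover have "(x - l) * ((y - l) / (x - l)) = y - l" using assms by simp
  ultimately show "l < bump l r x y t \<and> bump l r x y t \<le> y"
    using \<open>l < t\<close> \<open>t \<le> x\<close> assms by (simp add: bump_def del: times_divide_eq_right)
next
  assume "x < t" "t < r"
  have k: "(r - y) / (r - x) > 0" using assms by simp
  have "(r - t) * ((r - y) / (r - x)) < (r - x) * ((r - y) / (r - x))"
    using \<open>x < t\<close> k by (intro mult_strict_right_mono) auto
  moreover have "(r - t) * ((r - y) / (r - x)) > 0"
    using \<open>t < r\<close> k by (intro mult_pos_pos) auto
  moreover have "(r - x) * ((r - y) / (r - x)) = r - y" using assms by simp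
  ultimately show "y < bump l r x y t \<and> bump l r x y t < r"
    using \<open>x < t\<close> \<open>t < r\<close> assms by (simp add: bump_def del: times_divide_eq_right)
qed

lemma bump_outside: "t \<le> l \<or> r \<le> t \<Longrightarrow> bump l r x y t = t"
  by (simp add: bump_def)

lemma bump_bump:
  assumes "l < x" "x < r" "l < y" "y < r"
  shows "bump l r y x (bump l r x y t) = t"
proof -
  consider "t \<le> l \<or> r \<le> t" | "l < t" "t \<le> x" | "x < t" "t < r" by linarith
  then show ?thesis
  proof cases
    case 1
    then show ?thesis by (simp add: bump_outside)
  next
    case 2
    then have "bump l r x y t = l + (t - l) * ((y - l) / (x - l))"
      using assms by (simp add: bump_def)
    moreover have "bump l r y x (bump l r x y t) = l + (bump l r x y t - l) * ((x - l) / (y - l))"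
      using bump_range(1)[OF assms 2] assms by (simp add: bump_def)
    ultimately show ?thesis using assms by simp
  next
    case 3
    then have "bump l r x y t = r - (r - t) * ((r - y) / (r - x))"
      using assms by (simp add: bump_def)
    moreover have "bump l r y x (bump l r x y t) = r - (r - bump l r x y t) * ((r - x) / (r - y))"
      using bump_range(2)[OF assms 3] assms by (auto simp: bump_def)
    ultimately show ?thesis using assms by simp
  qed
qed

lemma strict_mono_bump:
  assumes "l < x" "x < r" "l < y" "y < r"
  shows "strict_mono (bump l r x y)"
proof (rule strict_monoI)
  fix s t :: rat assume "s < t"
  note b = bump_range[OF assms]
  \<comment> \<open>Points on the same linear piece are compared by its positive slope, points on
    different pieces by \<open>bump_range\<close>.\<close>
  consider "t \<le> l \<or> r \<le> s" | "s \<le> l" "l < t" "t \<le> x" | "s \<le> l" "x < t" "t < r" | "s \<le> l" "r \<le> t"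
    | "l < s" "t \<le> x" | "l < s" "s \<le> x" "x < t" "t < r" | "l < s" "s \<le> x" "r \<le> t"
    | "x < s" "t < r" | "x < s" "s < r" "r \<le> t" by linarith
  then show "bump l r x y s < bump l r x y t"
  proof cases
    case 1
    then show ?thesis using \<open>s < t\<close> by (auto simp: bump_outside)
  next
    case 2
    then show ?thesis using b(1)[of t] by (simp add: bump_outside)
  next
    case 3
    then show ?thesis using b(2)[of t] assms by (simp add: bump_outside)
  next
    case 4
    then show ?thesis using \<open>s < t\<close> by (simp add: bump_outside)
  next
    case 5
    have "(s - l) * ((y - l) / (x - l)) < (t - l) * ((y - l) / (x - l))"
      using assms \<open>s < t\<close> by (intro mult_strict_right_mono) auto
    then show ?thesis using 5 \<open>s < t\<close> assms by (simp add: bump_def del: times_divide_eq_right)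
  next
    case 6
    then show ?thesis using b(1)[of s] b(2)[of t] by simp
  next
    case 7
    then show ?thesis using b(1)[of s] assms by (simp add: bump_outside)
  next
    case 8
    have "(r - t) * ((r - y) / (r - x)) < (r - s) * ((r - y) / (r - x))"
      using assms \<open>s < t\<close> by (intro mult_strict_right_mono) auto
    then show ?thesis using 8 \<open>s < t\<close> assms by (simp add: bump_def del: times_divide_eq_right)
  next
    case 9
    then show ?thesis using b(2)[of s] by (simp add: bump_outside)
  qed
qed

lemma bij_bump:
  assumes "l < x" "x < r" "l < y" "y < r"
  shows "bij (bump l r x y)"
  by (rule bij_betw_byWitness[where f' = "bump l r y x"]) (use assms in \<open>auto simp: bump_bump\<close>)

lemma bump_self:
  assumes "l < x" "x < r"
  shows "bump l r x y x = y"
  using assms by (simp add: bump_def)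

text \<open>Two bumps suffice: the first moves \<open>c\<close> to \<open>a\<close>; the second has
  \<open>a\<close> as its fixed left end and corrects the other endpoint, moving the image of
  \<open>d\<close> to \<open>b\<close>.\<close>

lemma rat_aut_move_interval:
  fixes l r a b c d :: rat
  assumes "l < a" "a < b" "b < r" "l < c" "c < d" "d < r"
  obtains f where "bij f" "strict_mono f" "f c = a" "f d = b" "\<And>t. t \<le> l \<or> r \<le> t \<Longrightarrow> f t = t"
proof -
  define g where "g = bump l r c a"
  have g: "bij g" "strict_mono g" "g c = a"
    using assms by (auto simp: g_def bij_bump strict_mono_bump bump_self)
  have gd: "a < g d" "g d < r"
    using strict_monoD[OF g(2), of c d] strict_monoD[OF g(2), of d r] assms g(3)
    by (auto simp: g_def bump_outside)
  define h where "h = bump a r (g d) b"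
  have h: "bij h" "strict_mono h" "h (g d) = b" "h a = a"
    using assms gd by (auto simp: h_def bij_bump strict_mono_bump bump_self bump_outside)
  show ?thesis
  proof (rule that[of "h \<circ> g"])
    show "(h \<circ> g) t = t" if "t \<le> l \<or> r \<le> t" for t
      using that assms by (auto simp: g_def h_def bump_outside)
  qed (use g h rat_aut_comp in auto)
qed

section \<open>Clearing nowhere dense sets out of closed sets\<close>

text \<open>Stands in for "finite disjoint union of closed intervals". In the construction
  \<open>U\<close> is the reserved region, \<open>A\<close> the support already placed and
  \<open>B\<close> the next one. Quantifying over all \<open>A\<close> and \<open>B\<close> lets the
  same region be cleared again at every later stage.\<close>

definition clearable :: "rat set \<Rightarrow> bool" where
  "clearable U \<longleftrightarrow> closed U \<and>
     (\<forall>A B. closed A \<and> A \<inter> U = {} \<and> nowhere_dense B \<longrightarrow>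
        (\<exists>f\<in>fix_subgroup A. f ` B \<inter> U = {}))"

lemma clearable_empty: "clearable {}"
proof -
  have "id \<in> fix_subgroup A" for A by (auto simp: fix_subgroup_def strict_mono_def)
  then show ?thesis by (auto simp: clearable_def)
qed

text \<open>Since \<open>A\<close> is closed, it also misses a slightly larger interval from
  \<open>l\<close> to \<open>r\<close>. A gap of \<open>B\<close> inside it is carried onto
  \<open>{a..b}\<close> by an automorphism that moves nothing outside it, hence nothing in
  \<open>A\<close>.\<close>

lemma clearable_interval:
  assumes "a < b"
  shows "clearable {a..b}"
  unfolding clearable_def
proof (intro conjI allI impI)
  fix A B :: "rat set"
  assume *: "closed A \<and> A \<inter> {a..b} = {} \<and> nowhere_dense B"
  have A: "open (- A)" "a \<in> - A" "b \<in> - A" using * assms by auto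
  obtain l where l: "l < a" "{l..a} \<subseteq> - A"
  proof -
    obtain l u where lu: "l < a" "a < u" "{l..u} \<subseteq> - A"
      using open_rat_contains_interval[OF A(1,2)] by blast
    moreover from lu have "{l..a} \<subseteq> {l..u}" by auto
    ultimately show ?thesis using that by blast
  qed
  obtain r where r: "b < r" "{b..r} \<subseteq> - A"
  proof -
    obtain l r where lr: "l < b" "b < r" "{l..r} \<subseteq> - A"
      using open_rat_contains_interval[OF A(1,3)] by blast
    moreover from lr have "{b..r} \<subseteq> {l..r}" by auto
    ultimately show ?thesis using that by blast
  qed
  have outside: "t \<le> l \<or> r \<le> t" if "t \<in> A" for t
  proof (rule ccontr)
    assume "\<not> (t \<le> l \<or> r \<le> t)"
    then have "t \<in> {l..a} \<union> {a..b} \<union> {b..r}" by auto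
    with that l r * show False by blast
  qed
  have "nowhere_dense B" "l < r" using * l r assms by auto
  then obtain c d where cd: "l < c" "c < d" "d < r" "{c..d} \<inter> B = {}"
    by (rule nowhere_dense_rat_gap)
  obtain f where f: "bij f" "strict_mono f" "f c = a" "f d = b" "\<And>t. t \<le> l \<or> r \<le> t \<Longrightarrow> f t = t"
    using rat_aut_move_interval[OF l(1) assms r(1) cd(1-3)] by blast
  have "f \<in> fix_subgroup A" using f outside by (auto simp: fix_subgroup_def)
  \<comment> \<open>As \<open>{a..b}\<close> is \<open>{f c..f d}\<close>, a common point would come
    from a point of \<open>B\<close> in the gap \<open>{c..d}\<close>.\<close>
  moreover have "f ` B \<inter> {a..b} = {}"
    using cd(4) f(2) by (auto simp flip: f(3,4) simp: strict_mono_less_eq)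
  ultimately show "\<exists>f\<in>fix_subgroup A. f ` B \<inter> {a..b} = {}" by blast
qed simp

text \<open>First \<open>U\<close> is cleared by \<open>f\<close>, then \<open>V\<close> by a map
  \<open>g\<close> that fixes \<open>U\<close> pointwise as well as \<open>A\<close>. Being
  injective, \<open>g\<close> cannot bring a point from outside back into \<open>U\<close>.\<close>

lemma clearable_Un:
  assumes U: "clearable U" and V: "clearable V" and disj: "U \<inter> V = {}"
  shows "clearable (U \<union> V)"
  unfolding clearable_def
proof (intro conjI allI impI)
  show "closed (U \<union> V)" using U V by (simp add: clearable_def closed_Un)
  fix A B :: "rat set"
  assume *: "closed A \<and> A \<inter> (U \<union> V) = {} \<and> nowhere_dense B"
  moreover from this have "A \<inter> U = {}" by blast
  ultimately obtain f where f: "f \<in> fix_subgroup A" "f ` B \<inter> U = {}"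
    using U unfolding clearable_def by meson
  have "nowhere_dense (f ` B)"
    using f * by (auto simp: fix_subgroup_def intro: nowhere_dense_image_rat_aut)
  \<comment> \<open>Here closedness of \<open>U\<close>, built into \<open>clearable\<close>, makes
    \<open>A\<close> together with \<open>U\<close> an admissible set of fixed points.\<close>
  moreover have "closed (A \<union> U)" using * U by (auto simp: clearable_def)
  moreover have "(A \<union> U) \<inter> V = {}" using * disj by blast
  ultimately obtain g where g: "g \<in> fix_subgroup (A \<union> U)" "g ` f ` B \<inter> V = {}"
    using V unfolding clearable_def by meson
  have g': "bij g" "\<And>u. u \<in> U \<Longrightarrow> g u = u" using g(1) by (auto simp: fix_subgroup_def)
  have "g ` f ` B \<inter> U = {}"
  proof (rule ccontr)
    assume "g ` f ` B \<inter> U \<noteq> {}"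
    then obtain x where x: "x \<in> f ` B" "g x \<in> U" by blast
    then have "g (g x) = g x" using g' by blast
    then have "g x = x" using g'(1) by (simp add: bij_is_inj inj_eq)
    with x f(2) show False by auto
  qed
  with g(2) have "(g \<circ> f) ` B \<inter> (U \<union> V) = {}" by (auto simp: image_comp)
  moreover have "g \<circ> f \<in> fix_subgroup A"
    using f(1) g(1) by (auto simp: fix_subgroup_def rat_aut_comp)
  ultimately show "\<exists>f\<in>fix_subgroup A. f ` B \<inter> (U \<union> V) = {}" by blast
qed

text \<open>The reservation step. If the open interval already lies in \<open>U\<close>, any closed
  subinterval serves. Otherwise the part outside \<open>U\<close> is open and nonempty, so it
  contains a gap of \<open>A\<close>, which is added to \<open>U\<close>.\<close>

lemma clearable_extend:
  fixes a b :: rat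
  assumes U: "clearable U" and A: "closed A" "nowhere_dense A" "U \<inter> A = {}" and "a < b"
  obtains V c d where "U \<subseteq> V" "clearable V" "V \<inter> A = {}" "a < c" "c < d" "d < b" "{c..d} \<subseteq> V"
proof (cases "{a<..<b} \<subseteq> U")
  case True
  obtain c where c: "a < c" "c < b" using dense \<open>a < b\<close> by blast
  obtain d where d: "c < d" "d < b" using dense c by blast
  have "{c..d} \<subseteq> U" using True c d by auto
  with that U A c d show ?thesis by blast
next
  case False
  then obtain x where x: "x \<in> {a<..<b} - U" by blast
  have "open ({a<..<b} - U)" using U by (intro open_Diff) (auto simp: clearable_def)
  from open_rat_contains_interval[OF this x] obtain l r where
    lr: "l < x" "x < r" "{l..r} \<subseteq> {a<..<b} - U" by blast
  then have "l < r" by simp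
  with A(2) obtain c d where cd: "l < c" "c < d" "d < r" "{c..d} \<inter> A = {}"
    by (rule nowhere_dense_rat_gap)
  then have "{c..d} \<subseteq> {l..r}" by auto
  with lr(3) have sub: "{c..d} \<subseteq> {a<..<b} - U" by blast
  have "c \<in> {c..d}" "d \<in> {c..d}" using cd(2) by auto
  then have "c \<in> {a<..<b}" "d \<in> {a<..<b}" using sub by blast+
  moreover have "clearable (U \<union> {c..d})"
    using U clearable_interval[OF cd(2)] sub by (intro clearable_Un) auto
  moreover have "(U \<union> {c..d}) \<inter> A = {}" using A(3) cd(4) by blast
  ultimately show ?thesis using cd(2) that[of "U \<union> {c..d}" c d] by auto
qed

section \<open>The filter of nowhere dense supports\<close>

lemma subgroup_fix_subgroup: "subgroup (fix_subgroup E) rat_aut_group"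
proof (rule group.subgroupI[OF group_rat_aut_group])
  have "id \<in> fix_subgroup E" by (auto simp: fix_subgroup_def strict_mono_def)
  then show "fix_subgroup E \<noteq> {}" by blast
next
  fix f assume "f \<in> fix_subgroup E"
  then have f: "bij f" "strict_mono f" "\<And>q. q \<in> E \<Longrightarrow> f q = q"
    by (auto simp: fix_subgroup_def)
  have "inv_into UNIV f q = q" if "q \<in> E" for q
    using f that by (metis bij_is_inj inv_f_f)
  then show "inv\<^bsub>rat_aut_group\<^esub> f \<in> fix_subgroup E"
    using f by (auto simp: fix_subgroup_def inv_rat_aut bij_imp_bij_inv strict_mono_inv_rat)
qed (auto simp: fix_subgroup_def rat_aut_comp)

lemma fix_subgroup_antimono: "D \<subseteq> E \<Longrightarrow> fix_subgroup E \<subseteq> fix_subgroup D"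
  by (auto simp: fix_subgroup_def)

text \<open>A finite intersection of groups \<open>fix_subgroup E\<close> is the fixator of the
  union of the supports, again nowhere dense, so one support suffices. The empty intersection
  corresponds to the empty support.\<close>

lemma nowhere_dense_filter_iff:
  "H \<in> nowhere_dense_filter \<longleftrightarrow>
     subgroup H rat_aut_group \<and> (\<exists>E. nowhere_dense E \<and> fix_subgroup E \<subseteq> H)"
proof (intro iffI conjI)
  assume H: "H \<in> nowhere_dense_filter"
  then show "subgroup H rat_aut_group"
    by (simp add: nowhere_dense_filter_def filter_generated_by_def)
  obtain T where T: "finite T" "T \<subseteq> fix_subgroup ` {E. nowhere_dense E}"
    "carrier rat_aut_group \<inter> \<Inter>T \<subseteq> H"
    using H unfolding nowhere_dense_filter_def filter_generated_by_def setcompr_eq_image by blast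
  obtain C where C: "C \<subseteq> {E. nowhere_dense E}" "finite C" "T = fix_subgroup ` C"
    using finite_subset_image[OF T(1,2)] by blast
  have "nowhere_dense (\<Union>E\<in>C. E)" using C by (intro nowhere_dense_rat_UN) auto
  moreover have "fix_subgroup (\<Union>E\<in>C. E) \<subseteq> carrier rat_aut_group \<inter> \<Inter>T"
    unfolding C(3) by (auto simp: fix_subgroup_def)
  ultimately show "\<exists>E. nowhere_dense E \<and> fix_subgroup E \<subseteq> H" using T(3) by blast
next
  assume "subgroup H rat_aut_group \<and> (\<exists>E. nowhere_dense E \<and> fix_subgroup E \<subseteq> H)"
  then obtain E where "subgroup H rat_aut_group" "nowhere_dense E" "fix_subgroup E \<subseteq> H" by blast
  then show "H \<in> nowhere_dense_filter"
    unfolding nowhere_dense_filter_def filter_generated_by_def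
    by (auto intro!: exI[of _ "{fix_subgroup E}"])
qed

lemma (in group) subgroup_conj_subgroup:
  assumes H: "subgroup H G" and g: "g \<in> carrier G"
  shows "subgroup (conj_subgroup G g H) G"
proof -
  interpret H: subgroup H G by fact
  have eq: "conj_subgroup G g H = (\<lambda>h. g \<otimes> h \<otimes> inv g) ` H"
    by (auto simp: conj_subgroup_def l_coset_def r_coset_def)
  show ?thesis
  proof (rule subgroupI)
    show "conj_subgroup G g H \<subseteq> carrier G" using g by (auto simp: eq)
    show "conj_subgroup G g H \<noteq> {}" using H.one_closed unfolding eq by blast
  next
    fix x assume "x \<in> conj_subgroup G g H"
    then obtain h where h: "h \<in> H" "x = g \<otimes> h \<otimes> inv g" by (auto simp: eq)
    then have "inv x = g \<otimes> inv h \<otimes> inv g" using g by (simp add: inv_mult_group m_assoc)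
    then show "inv x \<in> conj_subgroup G g H" using h by (auto simp: eq)
  next
    fix x y assume "x \<in> conj_subgroup G g H" "y \<in> conj_subgroup G g H"
    then obtain h k where hk: "h \<in> H" "x = g \<otimes> h \<otimes> inv g" "k \<in> H" "y = g \<otimes> k \<otimes> inv g"
      by (auto simp: eq)
    moreover have "inv g \<otimes> (g \<otimes> z) = z" if "z \<in> carrier G" for z
      using g that by (simp flip: m_assoc)
    ultimately have "x \<otimes> y = g \<otimes> (h \<otimes> k) \<otimes> inv g"
      using g by (simp add: m_assoc)
    then show "x \<otimes> y \<in> conj_subgroup G g H" using hk by (auto simp: eq)
  qed
qed

text \<open>If \<open>f\<close> fixes the image of \<open>E\<close> under \<open>g\<close>, then
  conjugating \<open>f\<close> back by \<open>g\<close> gives an element that fixes \<open>E\<close>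
  and so lies in \<open>H\<close>.\<close>

lemma fix_subgroup_image_subset_conj:
  assumes g: "g \<in> carrier rat_aut_group" and H: "fix_subgroup E \<subseteq> H"
  shows "fix_subgroup (g ` E) \<subseteq> conj_subgroup rat_aut_group g H"
proof
  fix f assume f: "f \<in> fix_subgroup (g ` E)"
  let ?g' = "inv_into UNIV g"
  have g': "bij g" "strict_mono g" "bij ?g'" "strict_mono ?g'"
    using g by (auto simp: bij_imp_bij_inv strict_mono_inv_rat)
  have "?g' \<circ> f \<circ> g \<in> fix_subgroup E"
    using f g' by (auto simp: fix_subgroup_def rat_aut_comp bij_is_inj)
  then have "?g' \<circ> f \<circ> g \<in> H" using H by blast
  moreover have "f = g \<circ> (?g' \<circ> f \<circ> g) \<circ> ?g'"
    using g' by (auto simp: fun_eq_iff bij_is_surj surj_f_inv_f)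
  ultimately show "f \<in> conj_subgroup rat_aut_group g H"
    using g' by (auto simp: conj_subgroup_def l_coset_def r_coset_def inv_rat_aut)
qed

lemma normal_nowhere_dense_filter: "normal_subgroup_filter rat_aut_group nowhere_dense_filter"
  unfolding normal_subgroup_filter_def subgroup_filter_def
proof (intro conjI ballI allI impI)
  show "group rat_aut_group" by (rule group_rat_aut_group)
  show "nowhere_dense_filter \<noteq> {}"
    using subgroup_fix_subgroup nowhere_dense_empty nowhere_dense_filter_iff by blast
next
  fix H assume "H \<in> nowhere_dense_filter"
  then show "subgroup H rat_aut_group" by (simp add: nowhere_dense_filter_iff)
next
  fix H K assume "H \<in> nowhere_dense_filter" "subgroup K rat_aut_group \<and> H \<subseteq> K"
  then show "K \<in> nowhere_dense_filter" by (auto simp: nowhere_dense_filter_iff)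
next
  fix H K assume "H \<in> nowhere_dense_filter" "K \<in> nowhere_dense_filter"
  then obtain D E where *: "subgroup H rat_aut_group" "nowhere_dense D" "fix_subgroup D \<subseteq> H"
    "subgroup K rat_aut_group" "nowhere_dense E" "fix_subgroup E \<subseteq> K"
    by (auto simp: nowhere_dense_filter_iff)
  have "fix_subgroup (D \<union> E) \<subseteq> H \<inter> K"
    using * fix_subgroup_antimono[of D "D \<union> E"] fix_subgroup_antimono[of E "D \<union> E"] by blast
  moreover have "subgroup (H \<inter> K) rat_aut_group"
    using * by (intro group.subgroups_Inter_pair[OF group_rat_aut_group])
  moreover have "nowhere_dense (D \<union> E)" using * by (intro nowhere_dense_rat_Un)
  ultimately show "H \<inter> K \<in> nowhere_dense_filter"
    using nowhere_dense_filter_iff by blast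
next
  fix g H assume g: "g \<in> carrier rat_aut_group" and "H \<in> nowhere_dense_filter"
  then obtain E where *: "subgroup H rat_aut_group" "nowhere_dense E" "fix_subgroup E \<subseteq> H"
    by (auto simp: nowhere_dense_filter_iff)
  have "nowhere_dense (g ` E)" using g * by (simp add: nowhere_dense_image_rat_aut)
  with fix_subgroup_image_subset_conj[OF g *(3)]
    group.subgroup_conj_subgroup[OF group_rat_aut_group *(1) g]
  show "conj_subgroup rat_aut_group g H \<in> nowhere_dense_filter"
    by (auto simp: nowhere_dense_filter_iff)
qed

section \<open>Shift completeness\<close>

text \<open>Accumulating the first supports makes the sequence increasing; taking closures makes it
  closed, as clearing requires of the set to be fixed.\<close>

lemma nowhere_dense_filter_support_sequence:
  fixes H :: "nat \<Rightarrow> (rat \<Rightarrow> rat) set"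
  assumes "\<And>n. H n \<in> nowhere_dense_filter"
  obtains E where "mono E" "\<And>n. closed (E n)" "\<And>n. nowhere_dense (E n)"
    "\<And>n. fix_subgroup (E n) \<subseteq> H n"
proof -
  have "\<forall>n. \<exists>D. nowhere_dense D \<and> fix_subgroup D \<subseteq> H n"
    using assms by (simp add: nowhere_dense_filter_iff)
  then obtain D where D: "\<And>n. nowhere_dense (D n)" "\<And>n. fix_subgroup (D n) \<subseteq> H n" by metis
  let ?E = "\<lambda>n. closure (\<Union>i\<le>n. D i)"
  show ?thesis
  proof (rule that[of ?E])
    show "mono ?E" by (intro monoI closure_mono UN_mono) auto
    show "nowhere_dense (?E n)" for n
      using D by (intro nowhere_dense_closure nowhere_dense_rat_UN) auto
    show "fix_subgroup (?E n) \<subseteq> H n" for n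
    proof -
      have "D n \<subseteq> ?E n" using closure_subset[of "\<Union>i\<le>n. D i"] by blast
      then show ?thesis using fix_subgroup_antimono D(2) by blast
    qed
  qed simp
qed

lemma shift_sequence_exists:
  fixes E :: "nat \<Rightarrow> rat set"
  assumes E: "mono E" "\<And>n. closed (E n)" "\<And>n. nowhere_dense (E n)"
  obtains p where
    "\<And>n. shift_prod rat_aut_group p n \<in> carrier rat_aut_group"
    "\<And>n. p n \<in> fix_subgroup (shift_prod rat_aut_group p n ` E n)"
    "nowhere_dense (\<Union>n. shift_prod rat_aut_group p n ` E n)"
proof -
  \<comment> \<open>The state at stage \<open>n\<close> consists of the accumulated product
    \<open>s\<close> and the region \<open>U\<close> reserved so far. The clause for
    \<open>n = 0\<close> matches the start of \<open>shift_prod\<close>.\<close>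
  define P :: "nat \<Rightarrow> (rat \<Rightarrow> rat) \<times> rat set \<Rightarrow> bool" where "P n = (\<lambda>(s, U). bij s \<and> strict_mono s \<and> (n = 0 \<longrightarrow> s = id) \<and>
    clearable U \<and> U \<inter> s ` E n = {})" for n
  \<comment> \<open>One transition. The decoding \<open>from_nat\<close> runs through all pairs of
    rationals, so every open interval is treated at some stage.\<close>
  define Q :: "nat \<Rightarrow> (rat \<Rightarrow> rat) \<times> rat set \<Rightarrow> (rat \<Rightarrow> rat) \<times> rat set \<Rightarrow> bool" where "Q n = (\<lambda>(s, U) (t, V). U \<subseteq> V \<and> (\<exists>p\<in>fix_subgroup (s ` E n). t = p \<circ> s) \<and>
    (case from_nat n of (a, b) \<Rightarrow> a < b \<longrightarrow> (\<exists>c d. a < c \<and> c < d \<and> d < b \<and> {c..d} \<subseteq> V)))"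
    for n
  have "\<exists>y. P (Suc n) y \<and> Q n x y" if Px: "P n x" for n x
  proof -
    obtain s U where x: "x = (s, U)" by force
    obtain a b :: rat where ab: "from_nat n = (a, b)" by force
    have s: "bij s" "strict_mono s" and U: "clearable U" "U \<inter> s ` E n = {}"
      using Px by (auto simp: P_def x)
    have A: "closed (s ` E n)" "nowhere_dense (s ` E n)"
      using s E by (auto intro: closed_image_rat_aut nowhere_dense_image_rat_aut)
    \<comment> \<open>The new interval is reserved before the next shift is chosen: it avoids the
      current image of \<open>E n\<close>, so clearing \<open>V\<close> is compatible with fixing
      that image.\<close>
    obtain V where V: "U \<subseteq> V" "clearable V" "V \<inter> s ` E n = {}"
      "a < b \<longrightarrow> (\<exists>c d. a < c \<and> c < d \<and> d < b \<and> {c..d} \<subseteq> V)"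
    proof (cases "a < b")
      case True
      show ?thesis using clearable_extend[OF U(1) A U(2) True] that by metis
    next
      case False
      then show ?thesis using that U by blast
    qed
    have "nowhere_dense (s ` E (Suc n))" using s E by (simp add: nowhere_dense_image_rat_aut)
    moreover have "s ` E n \<inter> V = {}" using V(3) by blast
    ultimately obtain p where p: "p \<in> fix_subgroup (s ` E n)" "p ` s ` E (Suc n) \<inter> V = {}"
      using V(2) A(1) unfolding clearable_def by meson
    have "P (Suc n) (p \<circ> s, V)"
      using p s V(2) by (auto simp: P_def fix_subgroup_def rat_aut_comp)
    moreover have "Q n x (p \<circ> s, V)" using p(1) V(1,4) by (auto simp: Q_def x ab)
    ultimately show ?thesis by blast
  qed
  moreover have "P 0 (id, {})" by (auto simp: P_def clearable_empty strict_mono_def)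
  \<comment> \<open>Dependent choice turns the transitions into an infinite sequence of
    states.\<close>
  ultimately obtain x where x: "\<And>n. P n (x n)" "\<And>n. Q n (x n) (x (Suc n))"
    using dependent_nat_choice[of P Q] by blast
  define s U where "s n = fst (x n)" and "U n = snd (x n)" for n
  have s: "bij (s n)" "strict_mono (s n)" "s 0 = id" and U: "U n \<inter> s n ` E n = {}" for n
    using x(1)[of n] x(1)[of 0] by (auto simp: P_def s_def U_def split_beta)
  have "\<forall>n. \<exists>p\<in>fix_subgroup (s n ` E n). s (Suc n) = p \<circ> s n"
    using x(2) by (simp add: Q_def s_def split_beta)
  then obtain p where p: "\<And>n. p n \<in> fix_subgroup (s n ` E n)" "\<And>n. s (Suc n) = p n \<circ> s n"
    by metis
  have prod: "shift_prod rat_aut_group p n = s n" for n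
    by (induction n) (simp_all add: s(3) p(2))
  have "U n \<subseteq> U (Suc n)" for n
    using x(2)[of n] by (simp add: Q_def U_def split_beta)
  then have U_mono: "U m \<subseteq> U n" if "m \<le> n" for m n using that by (rule lift_Suc_mono_le)
  \<comment> \<open>As \<open>p n\<close> fixes the image of \<open>E n\<close>, the maps
    \<open>s n\<close> and \<open>s (Suc n)\<close> agree on \<open>E n\<close>; hence the images
    increase.\<close>
  have "s n ` E n \<subseteq> s (Suc n) ` E (Suc n)" for n
  proof
    fix y assume y: "y \<in> s n ` E n"
    then obtain q where q: "q \<in> E n" "y = s n q" by blast
    have "p n y = y" using p(1)[of n] y unfolding fix_subgroup_def by blast
    then have "y = s (Suc n) q" using q p(2) by simp
    moreover have "q \<in> E (Suc n)" using q monoD[OF E(1), of n "Suc n"] by auto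
    ultimately show "y \<in> s (Suc n) ` E (Suc n)" by blast
  qed
  then have s_mono: "s m ` E m \<subseteq> s n ` E n" if "m \<le> n" for m n
    using that by (rule lift_Suc_mono_le[where f = "\<lambda>n. s n ` E n"])
  \<comment> \<open>Both families increase, so disjointness at the common index
    \<open>max m n\<close> gives it for all pairs of indices.\<close>
  have disj: "U m \<inter> s n ` E n = {}" for m n
    using U[of "max m n"] U_mono[of m "max m n"] s_mono[of n "max m n"]
    by (meson disjoint_iff max.cobounded1 max.cobounded2 subsetD)
  have "nowhere_dense (\<Union>n. s n ` E n)"
    unfolding nowhere_dense_rat_iff
  proof (intro allI impI)
    fix a b :: rat assume "a < b"
    \<comment> \<open>The interval coded by \<open>n\<close> is handled in the transition from
      \<open>n\<close> to \<open>Suc n\<close>, so its reserved gap lies in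
      \<open>U (Suc n)\<close>.\<close>
    obtain n where "from_nat n = (a, b)" using from_nat_to_nat by blast
    then obtain c d where cd: "a < c" "c < d" "d < b" "{c..d} \<subseteq> U (Suc n)"
      using x(2)[of n] \<open>a < b\<close> by (auto simp: Q_def U_def split_beta)
    then have "{c..d} \<inter> (\<Union>n. s n ` E n) = {}" using disj[of "Suc n"] by blast
    with cd show "\<exists>c d. a < c \<and> c < d \<and> d < b \<and> {c..d} \<inter> (\<Union>n. s n ` E n) = {}" by blast
  qed
  with that[of p] s p(1) show ?thesis by (simp add: prod)
qed

lemma shift_complete_nowhere_dense_filter: "shift_complete rat_aut_group nowhere_dense_filter"
  unfolding shift_complete_def Let_def
proof (intro conjI allI impI)
  fix H :: "nat \<Rightarrow> (rat \<Rightarrow> rat) set"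
  assume "(\<forall>n. H n \<in> nowhere_dense_filter) \<and> decseq H"
  then have H: "\<And>n. H n \<in> nowhere_dense_filter" by blast
  obtain E where E: "mono E" "\<And>n. closed (E n)" "\<And>n. nowhere_dense (E n)"
    "\<And>n. fix_subgroup (E n) \<subseteq> H n"
    using nowhere_dense_filter_support_sequence[of H] H by blast
  obtain p where p:
    "\<And>n. shift_prod rat_aut_group p n \<in> carrier rat_aut_group"
    "\<And>n. p n \<in> fix_subgroup (shift_prod rat_aut_group p n ` E n)"
    "nowhere_dense (\<Union>n. shift_prod rat_aut_group p n ` E n)"
    using shift_sequence_exists[OF E(1-3)] by blast
  define K where "K n = conj_subgroup rat_aut_group (shift_prod rat_aut_group p n) (H n)" for n
  have fix_K: "fix_subgroup (shift_prod rat_aut_group p n ` E n) \<subseteq> K n" for n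
    unfolding K_def using p(1) E(4) by (rule fix_subgroup_image_subset_conj)
  have "subgroup (K n) rat_aut_group" for n
    unfolding K_def using H p(1)
    by (intro group.subgroup_conj_subgroup[OF group_rat_aut_group])
       (auto simp: nowhere_dense_filter_iff simp del: rat_aut_simps)
  then have "subgroup (\<Inter>n. K n) rat_aut_group"
    by (intro group.subgroups_Inter[OF group_rat_aut_group]) auto
  \<comment> \<open>Fixing the whole union means fixing the support of each \<open>K n\<close>, so a
    single nowhere dense set supports the intersection.\<close>
  moreover have "fix_subgroup (\<Union>n. shift_prod rat_aut_group p n ` E n) \<subseteq> (\<Inter>n. K n)"
    using fix_K by (fastforce simp: fix_subgroup_def)
  ultimately have "(\<Inter>n. K n) \<in> nowhere_dense_filter"
    using p(3) nowhere_dense_filter_iff by blast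
  moreover have "p n \<in> carrier rat_aut_group" for n
    using p(2)[of n] unfolding fix_subgroup_def by blast
  moreover have "p n \<in> K n" for n using p(2) fix_K by blast
  ultimately show "\<exists>p. (\<forall>n. p n \<in> carrier rat_aut_group) \<and>
      (\<forall>n. p n \<in> conj_subgroup rat_aut_group (shift_prod rat_aut_group p n) (H n)) \<and>
      (\<Inter>n. conj_subgroup rat_aut_group (shift_prod rat_aut_group p n) (H n))
        \<in> nowhere_dense_filter"
    unfolding K_def by blast
qed (rule normal_nowhere_dense_filter)

section \<open>Failure of closure under countable intersections\<close>

text \<open>Clearing a singleton gives the witness: in a gap \<open>{c..d}\<close> of the closure,
  the point \<open>c\<close> can be pushed out of the gap while the closure stays fixed.\<close>

lemma fix_subgroup_nontrivial:
  assumes "nowhere_dense E"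
  obtains f where "f \<in> fix_subgroup E" "f \<noteq> id"
proof -
  obtain c d where cd: "c < d" "{c..d} \<inter> closure E = {}"
    using nowhere_dense_rat_gap[OF nowhere_dense_closure[OF assms] zero_less_one] by metis
  have "closure E \<inter> {c..d} = {}" using cd(2) by blast
  then obtain f where f: "f \<in> fix_subgroup (closure E)" "f ` {c} \<inter> {c..d} = {}"
    using clearable_interval[OF cd(1)] nowhere_dense_rat_singleton[of c] closed_closure[of E]
    unfolding clearable_def by meson
  have "f \<in> fix_subgroup E" using f(1) fix_subgroup_antimono[OF closure_subset] by blast
  moreover have "f \<noteq> id" using f(2) cd(1) by auto
  ultimately show ?thesis by (rule that)
qed

lemma nowhere_dense_filter_not_countably_closed:
  "\<not> closed_under_countable_intersections nowhere_dense_filter"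
proof
  assume closed: "closed_under_countable_intersections nowhere_dense_filter"
  have "fix_subgroup {q} \<in> nowhere_dense_filter" for q
    using nowhere_dense_rat_singleton subgroup_fix_subgroup nowhere_dense_filter_iff by blast
  \<comment> \<open>The family is countable because its index set, the rationals, is. Only the
    identity fixes every rational.\<close>
  then have "(\<Inter>q. fix_subgroup {q}) \<in> nowhere_dense_filter"
    using closed unfolding closed_under_countable_intersections_def
    by (elim allE[of _ "range (\<lambda>q. fix_subgroup {q})"]) auto
  then obtain E where E: "nowhere_dense E" "fix_subgroup E \<subseteq> (\<Inter>q. fix_subgroup {q})"
    by (auto simp: nowhere_dense_filter_iff)
  obtain f where "f \<in> fix_subgroup E" "f \<noteq> id" using fix_subgroup_nontrivial[OF E(1)] .
  with E(2) show False by (auto simp: fix_subgroup_def fun_eq_iff)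
qed

theorem mainTheorem2:
  shows "shift_complete rat_aut_group nowhere_dense_filter \<and>
         \<not> closed_under_countable_intersections nowhere_dense_filter"
  using shift_complete_nowhere_dense_filter nowhere_dense_filter_not_countably_closed by blast

end
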